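(* Let $n\ge 1$. For every $[n]$-decorated binary tree $T$ of Shi type there exists a unique face $\Psi(T)$ of the Shi arrangement in $\mathbb{R}^n$ consisting of exactly the points $p=(p_1,\dots,p_n)\in\mathbb{R}^n$ satisfying: (1) for all $i,j\in[n]$, $p_i\le p_j$ if and only if $v_T(i)\preceq_T v_T(j)$; (2) for all $i<j$ in $[n]$, $p_i<p_j+1$ if and only if $v_T(i)\prec_T v^1_T(j)$; (3) for all $i<j$ in $[n]$, $p_i=p_j+1$ if and only if $v_T(i)=v^1_T(j)$ and $v^1_T(j)$ is a captive node. The map $T\mapsto\Psi(T)$ is a bijection from the set of $[n]$-decorated binary trees of Shi type to the set of faces of the Shi arrangement in $\mathbb{R}^n$. Moreover, such a $T$ has exactly $k$ free nodes if and only if $\Psi(T)$ has dimension $k$.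
   Context: $[n]=\{1,\dots,n\}$. A face of a finite arrangement of affine hyperplanes in $\mathbb{R}^n$ is a nonempty set obtained by choosing, for each hyperplane $\{a\cdot x=c\}$, one of $a\cdot x<c$, $=c$, $>c$ and taking the solution set; its dimension is that of its affine span. The Shi arrangement in $\mathbb{R}^n$ consists of the hyperplanes $x_i-x_j=0$ and $x_i-x_j=1$ for $1\le i<j\le n$. A binary tree is a rooted plane tree in which every vertex has 0 or 2 children; childless vertices are leaves, others nodes; the first child is the left child, the second the right child, with left and right edges. An internal edge joins two nodes. An $[n]$-decorated binary tree is a binary tree whose nodes are labeled by nonempty subsets of $[n]$ forming a set partition of $[n]$, with each right internal edge declared solid or dashed (all other edges solid). An internal edge is a descent if $\max A>\min B$, where $A$ is the label of the parent and $B$ that of the child; the tree is of Shi type if all its right internal edges are descents. A captive node is a node joined to its parent by a dashed edge; a free node is a node that is not captive. For a vertex $v$, $\rho(v)$ is the word in $\{E_0,E_1\}$ recording the path from the root to $v$ ($E_0$ left, $E_1$ right), $\dot\rho(v)$ the number of right edges on it. For distinct $v,w$: $v\prec_T w$ iff $\dot\rho(v)<\dot\rho(w)$, or $\dot\rho(v)=\dot\rho(w)$ and either $\rho(v)$ is a proper prefix of $\rho(w)$ or at the first differing position $\rho(v)$ has $E_1$ and $\rho(w)$ has $E_0$; $\preceq_T$ is $\prec_T$ or equality. $v_T(i)$ is the node whose label contains $i$, and $v^1_T(i)$ its right child. *)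

theory Defs
  imports "HOL-Analysis.Analysis" "HOL-Library.Sublist" "HOL-Library.Disjoint_Sets"
begin

text \<open>
  The index set \<open>[n]\<close> is rendered as a type \<open>'n :: {finite, linorder}\<close> with \<open>CARD('n) = n\<close>;
  only its linear order is used.  The ambient space is \<open>real ^ 'n\<close>.
\<close>

subsection \<open>Hyperplane arrangements\<close>

text \<open>The pair \<open>(a, c)\<close> stands for the hyperplane \<open>a \<bullet> x = c\<close>.\<close>

definition arrangement_faces :: "('v::euclidean_space \<times> real) set \<Rightarrow> 'v set set" where
  "arrangement_faces H = {F. F \<noteq> {} \<and>
     (\<exists>\<sigma>. (\<forall>h\<in>H. \<sigma> h \<in> {(<), (=), (>)}) \<and>
          F = {x. \<forall>(a, c)\<in>H. \<sigma> (a, c) (a \<bullet> x) c})}"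

definition shi_arrangement :: "((real, 'n::{finite,linorder}) vec \<times> real) set" where
  "shi_arrangement = {(axis i 1 - axis j 1, c) | i j c. i < j \<and> c \<in> {0, 1}}"

subsection \<open>Decorated binary trees\<close>

text \<open>
  \<open>Node A L d R\<close> is a node with label \<open>A\<close>, left subtree \<open>L\<close> and right subtree \<open>R\<close>; the
  flag \<open>d\<close> says that the edge to the right child is dashed.  Only internal edges can be dashed,
  so \<open>decorated\<close> below requires \<open>d = False\<close> if \<open>R = Leaf\<close>.
\<close>

datatype 'a dtree = Leaf | Node "'a set" "'a dtree" bool "'a dtree"

datatype step = E0 | E1

text \<open>A vertex \<open>v\<close> is identified with the word \<open>\<rho>(v)\<close> of the path from the root to it.\<close>

fun nodes :: "'a dtree \<Rightarrow> step list set" where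
  "nodes Leaf = {}"
| "nodes (Node A L d R) = {[]} \<union> (#) E0 ` nodes L \<union> (#) E1 ` nodes R"

fun node_label :: "'a dtree \<Rightarrow> step list \<Rightarrow> 'a set" where
  "node_label Leaf v = {}"
| "node_label (Node A L d R) [] = A"
| "node_label (Node A L d R) (E0 # v) = node_label L v"
| "node_label (Node A L d R) (E1 # v) = node_label R v"

text \<open>\<open>right_dashed T v\<close>: the edge from the node \<open>v\<close> to its right child is dashed.\<close>

fun right_dashed :: "'a dtree \<Rightarrow> step list \<Rightarrow> bool" where
  "right_dashed Leaf v = False"
| "right_dashed (Node A L d R) [] = d"
| "right_dashed (Node A L d R) (E0 # v) = right_dashed L v"
| "right_dashed (Node A L d R) (E1 # v) = right_dashed R v"

definition left_child :: "step list \<Rightarrow> step list" where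
  "left_child v = v @ [E0]"

definition right_child :: "step list \<Rightarrow> step list" where
  "right_child v = v @ [E1]"

definition decorated :: "'a dtree \<Rightarrow> bool" where
  "decorated T \<longleftrightarrow>
     inj_on (node_label T) (nodes T) \<and>
     partition_on UNIV (node_label T ` nodes T) \<and>
     (\<forall>v\<in>nodes T. right_dashed T v \<longrightarrow> right_child v \<in> nodes T)"

definition internal_edge :: "'a dtree \<Rightarrow> step list \<Rightarrow> step list \<Rightarrow> bool" where
  "internal_edge T v w \<longleftrightarrow>
     v \<in> nodes T \<and> w \<in> nodes T \<and> (w = left_child v \<or> w = right_child v)"

definition descent :: "'a::linorder dtree \<Rightarrow> step list \<Rightarrow> step list \<Rightarrow> bool" where
  "descent T v w \<longleftrightarrow> internal_edge T v w \<and> Max (node_label T v) > Min (node_label T w)"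

definition shi_type :: "'a::linorder dtree \<Rightarrow> bool" where
  "shi_type T \<longleftrightarrow> (\<forall>v. internal_edge T v (right_child v) \<longrightarrow> descent T v (right_child v))"

definition shi_trees :: "'n::{finite,linorder} dtree set" where
  "shi_trees = {T. decorated T \<and> shi_type T}"

definition captive :: "'a dtree \<Rightarrow> step list \<Rightarrow> bool" where
  "captive T w \<longleftrightarrow> w \<in> nodes T \<and> (\<exists>v\<in>nodes T. w = right_child v \<and> right_dashed T v)"

definition free_nodes :: "'a dtree \<Rightarrow> step list set" where
  "free_nodes T = {v \<in> nodes T. \<not> captive T v}"

subsection \<open>The order on vertices\<close>

text \<open>Since vertices are words, the order does not depend on the tree.\<close>

definition rho_dot :: "step list \<Rightarrow> nat" where
  "rho_dot v = count_list v E1"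

definition vertex_less :: "step list \<Rightarrow> step list \<Rightarrow> bool" (infix "\<prec>\<^sub>T" 50) where
  "v \<prec>\<^sub>T w \<longleftrightarrow> v \<noteq> w \<and>
     (rho_dot v < rho_dot w \<or>
      rho_dot v = rho_dot w \<and>
        (strict_prefix v w \<or> (\<exists>u v' w'. v = u @ E1 # v' \<and> w = u @ E0 # w')))"

definition vertex_le :: "step list \<Rightarrow> step list \<Rightarrow> bool" (infix "\<preceq>\<^sub>T" 50) where
  "v \<preceq>\<^sub>T w \<longleftrightarrow> v \<prec>\<^sub>T w \<or> v = w"

definition node_of :: "'a dtree \<Rightarrow> 'a \<Rightarrow> step list" where
  "node_of T i = (THE v. v \<in> nodes T \<and> i \<in> node_label T v)"

subsection \<open>The face of a tree\<close>

definition face_conditions :: "'n::{finite,linorder} dtree \<Rightarrow> (real, 'n) vec \<Rightarrow> bool" where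
  "face_conditions T p \<longleftrightarrow>
     (\<forall>i j. p $ i \<le> p $ j \<longleftrightarrow> node_of T i \<preceq>\<^sub>T node_of T j) \<and>
     (\<forall>i j. i < j \<longrightarrow> (p $ i < p $ j + 1 \<longleftrightarrow> node_of T i \<prec>\<^sub>T right_child (node_of T j))) \<and>
     (\<forall>i j. i < j \<longrightarrow> (p $ i = p $ j + 1 \<longleftrightarrow>
        node_of T i = right_child (node_of T j) \<and> captive T (right_child (node_of T j))))"

definition Psi :: "'n::{finite,linorder} dtree \<Rightarrow> (real, 'n) vec set" where
  "Psi T = (THE F. F \<in> arrangement_faces shi_arrangement \<and> (\<forall>p. p \<in> F \<longleftrightarrow> face_conditions T p))"

end

theory Submission
  imports Defs
begin

text \<open>
  The order on vertices compares the number of right edges first, and then the words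
  lexicographically with \<open>E1 < E0\<close> and prefixes first.  In this order the left child of \<open>u\<close> is the
  immediate successor of \<open>u\<close> among the vertices with the same number of right edges, and in the
  lexicographic order the right child of \<open>u\<close> is the immediate successor of \<open>u\<close>.

  A point in the face of \<open>T\<close> is obtained by giving a node \<open>v\<close> the integer part \<open>\<rho>\<close>-dot of \<open>v\<close> and a
  fractional part that increases with the lexicographic position of the first free node above \<open>v\<close>.
  The coordinates at distinct free nodes can be perturbed independently, and they determine the
  others because each right edge is a descent; this gives the dimension.

  Conversely, processing the coordinates of a point \<open>p\<close> in increasing order, each new block must be
  put at the largest vertex among the left child of the previous vertex and the right children of
  the vertices whose labels force a descent at distance at least 1.
\<close>

section \<open>The order on words\<close>

text \<open>Prefixes first and \<open>E1\<close> below \<open>E0\<close> is \<open>lexord\<close> of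
  a one-pair relation, so transitivity and totality come from general facts about
  \<open>lexord\<close>.\<close>

abbreviation lex_less :: "step list \<Rightarrow> step list \<Rightarrow> bool" (infix "\<sqsubset>" 50) where
  "v \<sqsubset> w \<equiv> (v, w) \<in> lexord {(E1, E0)}"

lemma lex_less_iff:
  "v \<sqsubset> w \<longleftrightarrow> strict_prefix v w \<or> (\<exists>u v' w'. v = u @ E1 # v' \<and> w = u @ E0 # w')"
proof -
  have "strict_prefix v w \<longleftrightarrow> (\<exists>a u. w = v @ a # u)"
    by (metis strict_prefixI' strict_prefixE')
  then show ?thesis
    unfolding lexord_def by blast
qed

lemma lex_less_irrefl: "\<not> v \<sqsubset> v"
  by (rule lexord_irreflexive) simp

lemma lex_less_trans: "u \<sqsubset> v \<Longrightarrow> v \<sqsubset> w \<Longrightarrow> u \<sqsubset> w"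
  by (rule lexord_trans) (auto simp: trans_def)

lemma lex_less_linear: "v \<sqsubset> w \<or> v = w \<or> w \<sqsubset> v"
proof (rule lexord_linear)
  have "(a, b) \<in> {(E1, E0)} \<or> a = b \<or> (b, a) \<in> {(E1, E0)}" for a b
    by (cases a; cases b) auto
  then show "\<forall>a b. (a, b) \<in> {(E1, E0)} \<or> a = b \<or> (b, a) \<in> {(E1, E0)}" by blast
qed

lemma vertex_less_iff:
  "v \<prec>\<^sub>T w \<longleftrightarrow> rho_dot v < rho_dot w \<or> rho_dot v = rho_dot w \<and> v \<sqsubset> w"
  unfolding vertex_less_def lex_less_iff[symmetric] using lex_less_irrefl by auto

lemma vertex_less_irrefl: "\<not> v \<prec>\<^sub>T v"
  by (simp add: vertex_less_def)

lemma vertex_less_trans: "u \<prec>\<^sub>T v \<Longrightarrow> v \<prec>\<^sub>T w \<Longrightarrow> u \<prec>\<^sub>T w"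
  unfolding vertex_less_iff using lex_less_trans by auto

lemma vertex_less_linear: "v \<prec>\<^sub>T w \<or> v = w \<or> w \<prec>\<^sub>T v"
  unfolding vertex_less_iff using lex_less_linear[of v w] by auto

lemma vertex_le_iff: "v \<preceq>\<^sub>T w \<longleftrightarrow> \<not> w \<prec>\<^sub>T v"
  unfolding vertex_le_def
  using vertex_less_linear[of v w] vertex_less_trans[of v w v] vertex_less_irrefl[of v] by blast

lemma rho_dot_simps [simp]:
  "rho_dot [] = 0" "rho_dot (v @ w) = rho_dot v + rho_dot w"
  "rho_dot (E0 # w) = rho_dot w" "rho_dot (E1 # w) = Suc (rho_dot w)"
  by (simp_all add: rho_dot_def)

lemma rho_dot_replicate [simp]: "rho_dot (replicate m E1) = m"
  by (induction m) auto

section \<open>Children as successors in the two orders\<close>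

lemma lex_less_append: "w \<noteq> [] \<Longrightarrow> v \<sqsubset> v @ w"
  by (cases w) (auto simp: lexord_def)

text \<open>The appended letter matters only when it is itself the first difference; then it is the
  larger letter \<open>E0\<close>, and \<open>v\<close> has \<open>E1\<close> in its place.\<close>

lemma lex_less_snocD:
  assumes "v \<sqsubset> u @ [s]"
  shows "v \<sqsubset> u \<or> v = u \<or> s = E0 \<and> (\<exists>v'. v = u @ E1 # v')"
proof -
  from assms consider "strict_prefix v (u @ [s])"
    | x v' w' where "v = x @ E1 # v'" "u @ [s] = x @ E0 # w'"
    unfolding lex_less_iff by blast
  then show ?thesis
  proof cases
    case 1
    then have "prefix v u" by (auto simp: strict_prefix_def)
    then show ?thesis unfolding lex_less_iff strict_prefix_def by auto
  next
    case 2
    then show ?thesis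
    proof (cases w' rule: rev_cases)
      case Nil
      with 2 show ?thesis by auto
    next
      case (snoc w'' t)
      with 2 have "u = x @ E0 # w''" by simp
      with 2 show ?thesis unfolding lex_less_iff by blast
    qed
  qed
qed

lemma lex_less_snoc_E1D: "v \<sqsubset> u @ [E1] \<Longrightarrow> v \<sqsubset> u \<or> v = u"
  using lex_less_snocD by blast

text \<open>The last case of \<open>lex_less_snocD\<close> cannot occur: a word extending
  \<open>u @ [E1]\<close> has more right edges than \<open>left_child u\<close>.\<close>

lemma vertex_less_left_childD: "v \<prec>\<^sub>T left_child u \<Longrightarrow> v \<preceq>\<^sub>T u"
  unfolding left_child_def vertex_le_def vertex_less_iff
  by (auto dest!: lex_less_snocD)

lemma vertex_less_left_child: "v \<prec>\<^sub>T left_child v"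
  by (simp add: left_child_def vertex_less_iff lex_less_append)

lemma vertex_less_right_child: "v \<prec>\<^sub>T right_child v"
  by (simp add: right_child_def vertex_less_iff)

lemma right_child_mono:
  assumes "u \<prec>\<^sub>T v" shows "right_child u \<prec>\<^sub>T right_child v"
proof -
  have "u @ [E1] \<sqsubset> v @ [E1]" if "u \<sqsubset> v" "rho_dot u = rho_dot v"
  proof -
    from that(1) consider "strict_prefix u v" | x u' v' where "u = x @ E1 # u'" "v = x @ E0 # v'"
      unfolding lex_less_iff by blast
    then show ?thesis
    proof cases
      case 1
      then obtain s z where v: "v = u @ s # z" by (auto elim: strict_prefixE')
      \<comment> \<open>Equal numbers of right edges leave no \<open>E1\<close> in the part of
        \<open>v\<close> beyond \<open>u\<close>. The \<open>E1\<close> appended to \<open>u\<close>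
        therefore meets an \<open>E0\<close> of \<open>v\<close>.\<close>
      with that(2) have "s = E0" by (cases s) auto
      with v show ?thesis unfolding lex_less_iff by auto
    next
      case 2
      then show ?thesis unfolding lex_less_iff by auto
    qed
  qed
  with assms show ?thesis
    unfolding vertex_less_iff right_child_def by auto
qed

lemma right_child_less_iff: "right_child u \<prec>\<^sub>T right_child v \<longleftrightarrow> u \<prec>\<^sub>T v"
  using right_child_mono[of u v] right_child_mono[of v u] vertex_less_linear[of u v]
    vertex_less_irrefl vertex_less_trans[of "right_child u" "right_child v" "right_child u"] by blast

lemma not_vertex_less_Nil: "\<not> v \<prec>\<^sub>T []"
  by (simp add: vertex_less_iff)

lemma left_child_inject [simp]: "left_child u = left_child v \<longleftrightarrow> u = v"
  and right_child_inject [simp]: "right_child u = right_child v \<longleftrightarrow> u = v"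
  and left_child_neq_right_child [simp]: "left_child u \<noteq> right_child v" "right_child v \<noteq> left_child u"
  by (auto simp: left_child_def right_child_def)

lemma vertex_cases:
  obtains "v = []" | u where "v = left_child u" | u where "v = right_child u"
proof (cases v rule: rev_cases)
  case (snoc u s)
  then show ?thesis using that(2,3) by (cases s) (auto simp: left_child_def right_child_def)
qed (use that(1) in simp)

section \<open>Trees as sets of words\<close>

lemma finite_nodes: "finite (nodes T)"
  by (induction T) auto

lemma nodes_butlast: "v @ [s] \<in> nodes T \<Longrightarrow> v \<in> nodes T"
proof (induction T arbitrary: v)
  case (Node A L d R)
  then show ?case by (cases v) auto
qed simp

lemma nodes_left_childD: "left_child v \<in> nodes T \<Longrightarrow> v \<in> nodes T"
  and nodes_right_childD: "right_child v \<in> nodes T \<Longrightarrow> v \<in> nodes T"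
  by (auto simp: left_child_def right_child_def dest: nodes_butlast)

lemma dtree_eqI:
  assumes "nodes T = nodes T'"
    and "\<And>v. v \<in> nodes T \<Longrightarrow> node_label T v = node_label T' v"
    and "\<And>v. v \<in> nodes T \<Longrightarrow> right_dashed T v = right_dashed T' v"
  shows "T = T'"
  using assms
proof (induction T arbitrary: T')
  case Leaf
  then show ?case by (cases T') auto
next
  case (Node A L d R)
  then obtain A' L' d' R' where T': "T' = Node A' L' d' R'" by (cases T') auto
  note eqs = Node.prems[unfolded T']
  have nL: "nodes L = nodes L'" and nR: "nodes R = nodes R'"
  proof -
    have "v \<in> nodes L \<longleftrightarrow> v \<in> nodes L'" "v \<in> nodes R \<longleftrightarrow> v \<in> nodes R'" for v
      using arg_cong[OF eqs(1), of "\<lambda>W. E0 # v \<in> W"] arg_cong[OF eqs(1), of "\<lambda>W. E1 # v \<in> W"]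
      by auto
    then show "nodes L = nodes L'" "nodes R = nodes R'" by blast+
  qed
  have "L = L'"
  proof (rule Node.IH(1)[OF nL])
    fix v assume "v \<in> nodes L"
    then show "node_label L v = node_label L' v" "right_dashed L v = right_dashed L' v"
      using eqs(2)[of "E0 # v"] eqs(3)[of "E0 # v"] by auto
  qed
  moreover have "R = R'"
  proof (rule Node.IH(2)[OF nR])
    fix v assume "v \<in> nodes R"
    then show "node_label R v = node_label R' v" "right_dashed R v = right_dashed R' v"
      using eqs(2)[of "E1 # v"] eqs(3)[of "E1 # v"] by auto
  qed
  ultimately show ?case using T' eqs(2)[of "[]"] eqs(3)[of "[]"] by auto
qed

text \<open>The words of \<open>W\<close> that start with \<open>s\<close>, stripped of
  \<open>s\<close>, form the nodes of a subtree; there are fewer of them because \<open>[]\<close>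
  is lost. Labels and dashes are shifted accordingly, hence \<open>lab\<close> and
  \<open>dsh\<close> are generalized in the induction.\<close>

lemma dtree_of_words:
  assumes "finite W" and "\<And>v s. v @ [s] \<in> W \<Longrightarrow> v \<in> W"
  shows "\<exists>T. nodes T = W \<and> (\<forall>v\<in>W. node_label T v = lab v \<and> (right_dashed T v \<longleftrightarrow> dsh v))"
  using assms
proof (induction "card W" arbitrary: W lab dsh rule: less_induct)
  case less
  show ?case
  proof (cases "W = {}")
    case True
    then show ?thesis by (intro exI[of _ Leaf]) auto
  next
    case False
    have Nil: "[] \<in> W"
    proof -
      obtain v where "v \<in> W" using False by blast
      then show ?thesis by (induction v rule: rev_induct) (auto dest: less.prems(2))
    qed
    have sub: "\<exists>T. nodes T = {v. s # v \<in> W} \<and> (\<forall>v\<in>{v. s # v \<in> W}.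
        node_label T v = lab (s # v) \<and> (right_dashed T v \<longleftrightarrow> dsh (s # v)))" for s
    proof (rule less.hyps)
      have inj: "inj_on ((#) s) {v. s # v \<in> W}" by simp
      have "(#) s ` {v. s # v \<in> W} \<subset> W" using Nil by auto
      then show "card {v. s # v \<in> W} < card W"
        using psubset_card_mono[OF less.prems(1)] card_image[OF inj] by metis
      show "finite {v. s # v \<in> W}"
        using less.prems(1) by (intro finite_vimageI[of W "(#) s", unfolded vimage_def]) auto
    qed (use less.prems(2)[of "s # _"] in auto)
    from sub[of E0] obtain L where L: "nodes L = {v. E0 # v \<in> W}" "\<forall>v\<in>{v. E0 # v \<in> W}.
        node_label L v = lab (E0 # v) \<and> (right_dashed L v \<longleftrightarrow> dsh (E0 # v))"
      by (elim exE conjE)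
    from sub[of E1] obtain R where R: "nodes R = {v. E1 # v \<in> W}" "\<forall>v\<in>{v. E1 # v \<in> W}.
        node_label R v = lab (E1 # v) \<and> (right_dashed R v \<longleftrightarrow> dsh (E1 # v))"
      by (elim exE conjE)
    let ?T = "Node (lab []) L (dsh []) R"
    have "v \<in> nodes ?T \<longleftrightarrow> v \<in> W" for v
    proof (cases v)
      case (Cons s u)
      then show ?thesis using L(1) R(1) by (cases s) auto
    qed (use Nil in simp)
    moreover have "node_label ?T v = lab v \<and> (right_dashed ?T v \<longleftrightarrow> dsh v)" if "v \<in> W" for v
    proof (cases v)
      case (Cons s u)
      then show ?thesis using L(2) R(2) that by (cases s) auto
    qed simp
    ultimately show ?thesis by blast
  qed
qed

section \<open>Nodes and labels of decorated trees\<close>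

lemma decorated_ex1_node:
  assumes "decorated T" shows "\<exists>!v. v \<in> nodes T \<and> i \<in> node_label T v"
proof -
  have part: "partition_on UNIV (node_label T ` nodes T)" and inj: "inj_on (node_label T) (nodes T)"
    using assms by (auto simp: decorated_def)
  have "i \<in> \<Union> (node_label T ` nodes T)" using part by (simp add: partition_on_def)
  then obtain v where v: "v \<in> nodes T" "i \<in> node_label T v" by blast
  have "w = v" if "w \<in> nodes T" "i \<in> node_label T w" for w
  proof -
    have "node_label T v = node_label T w"
      using part v that unfolding partition_on_def disjoint_def by blast
    with inj v that show ?thesis by (auto dest: inj_onD)
  qed
  with v show ?thesis by blast
qed

lemma
  assumes "decorated T"
  shows node_of_in_nodes: "node_of T i \<in> nodes T"
    and in_node_label_node_of: "i \<in> node_label T (node_of T i)"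
  using theI'[OF decorated_ex1_node[OF assms]] unfolding node_of_def by auto

lemma node_of_eqI: "decorated T \<Longrightarrow> v \<in> nodes T \<Longrightarrow> i \<in> node_label T v \<Longrightarrow> node_of T i = v"
  unfolding node_of_def by (rule the1_equality[OF decorated_ex1_node]) auto

lemma node_of_eq_iff:
  "decorated T \<Longrightarrow> v \<in> nodes T \<Longrightarrow> node_of T i = v \<longleftrightarrow> i \<in> node_label T v"
  using node_of_eqI in_node_label_node_of by metis

lemma node_label_nonempty: "decorated T \<Longrightarrow> v \<in> nodes T \<Longrightarrow> node_label T v \<noteq> {}"
  unfolding decorated_def partition_on_def by auto

lemma nodes_eq_range_node_of: "decorated T \<Longrightarrow> nodes T = range (node_of T)"
proof (intro set_eqI iffI)
  fix v assume *: "decorated T" "v \<in> nodes T"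
  then obtain i where "i \<in> node_label T v" using node_label_nonempty by blast
  with * show "v \<in> range (node_of T)" using node_of_eqI by (metis rangeI)
qed (auto simp: node_of_in_nodes)

text \<open>Conditions (2) and (3) speak only of pairs \<open>i < j\<close>. The minimum of the
  child's label and the maximum of the parent's label are such a pair for every right internal
  edge.\<close>

lemma shi_trees_descent:
  fixes T :: "'n::{finite,linorder} dtree"
  assumes "T \<in> shi_trees" "right_child v \<in> nodes T"
  obtains i j where "i < j" "node_of T i = right_child v" "node_of T j = v"
proof -
  have dec: "decorated T" and "shi_type T" using assms(1) by (auto simp: shi_trees_def)
  have v: "v \<in> nodes T" using assms(2) by (rule nodes_right_childD)
  have "descent T v (right_child v)"
    using \<open>shi_type T\<close> v assms(2) by (simp add: shi_type_def internal_edge_def)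
  then have "Min (node_label T (right_child v)) < Max (node_label T v)"
    by (simp add: descent_def)
  moreover have "Min (node_label T (right_child v)) \<in> node_label T (right_child v)"
    "Max (node_label T v) \<in> node_label T v"
    using node_label_nonempty[OF dec] v assms(2) by (auto intro!: Min_in Max_in)
  ultimately show thesis
    using that node_of_eqI[OF dec] v assms(2) by blast
qed

section \<open>Free roots\<close>

text \<open>Dashed edges form chains of right edges. A captive node is a nonempty word whose parent
  is its \<open>butlast\<close>, so climbing ends at the free top of its chain.\<close>

function free_root :: "'a dtree \<Rightarrow> step list \<Rightarrow> step list" where
  "free_root T w = (if captive T w then free_root T (butlast w) else w)"
  by auto
termination
  by (relation "Wellfounded.measure (\<lambda>(T, w). length w)") (auto simp: captive_def right_child_def)

declare free_root.simps [simp del]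

lemma captive_induct [consumes 1, case_names free captive]:
  assumes "w \<in> nodes T"
    and "\<And>w. w \<in> free_nodes T \<Longrightarrow> P w"
    and "\<And>u. u \<in> nodes T \<Longrightarrow> captive T (right_child u) \<Longrightarrow> P u \<Longrightarrow> P (right_child u)"
  shows "P w"
  using assms(1)
proof (induction "length w" arbitrary: w rule: less_induct)
  case less
  show ?case
  proof (cases "captive T w")
    case True
    then obtain u where u: "u \<in> nodes T" "w = right_child u" unfolding captive_def by blast
    then have "P u" by (intro less.hyps) (auto simp: right_child_def)
    with u True show ?thesis using assms(3) by blast
  next
    case False
    with less.prems show ?thesis by (intro assms(2)) (simp add: free_nodes_def)
  qed
qed

lemma free_root_free: "w \<in> free_nodes T \<Longrightarrow> free_root T w = w"
  by (simp add: free_nodes_def free_root.simps)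

lemma free_root_captive: "captive T (right_child u) \<Longrightarrow> free_root T (right_child u) = free_root T u"
  by (subst free_root.simps) (simp add: right_child_def)

lemma free_root_in_free_nodes: "w \<in> nodes T \<Longrightarrow> free_root T w \<in> free_nodes T"
  by (induction rule: captive_induct) (simp_all add: free_root_free free_root_captive)

lemma free_root_image: "free_root T ` nodes T = free_nodes T"
proof
  show "free_nodes T \<subseteq> free_root T ` nodes T"
    using free_root_free by (force simp: free_nodes_def image_iff)
qed (auto simp: free_root_in_free_nodes)

text \<open>All edges of a dashed chain are right edges. Consequently a node is recovered from its
  free root and its number of right edges.\<close>

lemma free_root_replicate:
  "w \<in> nodes T \<Longrightarrow> w = free_root T w @ replicate (rho_dot w - rho_dot (free_root T w)) E1
    \<and> rho_dot (free_root T w) \<le> rho_dot w"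
proof (induction rule: captive_induct)
  case (captive u)
  define r where "r = free_root T u"
  define m where "m = rho_dot u - rho_dot r"
  have u: "u = r @ replicate m E1" "rho_dot r \<le> rho_dot u"
    using captive.IH by (simp_all add: r_def m_def)
  have r: "free_root T (right_child u) = r"
    using free_root_captive[OF captive.hyps(2)] by (simp add: r_def)
  have "rho_dot (right_child u) - rho_dot r = Suc m"
    using u(2) by (simp add: m_def right_child_def)
  moreover have "right_child u = r @ replicate (Suc m) E1"
    by (simp add: u(1) right_child_def replicate_append_same)
  moreover have "rho_dot r \<le> rho_dot (right_child u)"
    using u(2) by (simp add: right_child_def)
  ultimately show ?case unfolding r by argo
qed (simp add: free_root_free)

lemma free_root_rho_dot_inject:
  assumes "v \<in> nodes T" "w \<in> nodes T" "free_root T v = free_root T w" "rho_dot v = rho_dot w"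
  shows "v = w"
  using free_root_replicate[OF assms(1)] free_root_replicate[OF assms(2)] assms(3,4) by simp

lemma free_root_eq_right_child:
  assumes "v \<in> nodes T" "w \<in> nodes T" "free_root T v = free_root T w" "rho_dot w = Suc (rho_dot v)"
  shows "w = right_child v"
proof -
  define r where "r = free_root T v"
  define m where "m = rho_dot v - rho_dot r"
  have v: "v = r @ replicate m E1" "rho_dot r \<le> rho_dot v"
    using free_root_replicate[OF assms(1)] by (simp_all add: r_def m_def)
  have "w = r @ replicate (rho_dot w - rho_dot r) E1"
    using free_root_replicate[OF assms(2)] assms(3) by (simp add: r_def)
  moreover have "rho_dot w - rho_dot r = Suc m"
    using v(2) assms(4) by (simp add: m_def)
  ultimately show ?thesis by (simp add: v(1) right_child_def replicate_append_same)
qed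

text \<open>Lexicographically, the right child of \<open>u\<close> comes immediately after \<open>u\<close>; hence no free node
  lies strictly between a node and its free root.\<close>

lemma free_root_greatest:
  assumes "w \<in> nodes T"
  shows "u \<in> free_nodes T \<Longrightarrow> u \<sqsubset> w \<or> u = w \<Longrightarrow> u \<sqsubset> free_root T w \<or> u = free_root T w"
  using assms
proof (induction rule: captive_induct)
  case (captive x)
  then have "u \<noteq> right_child x" by (auto simp: free_nodes_def)
  then have "u \<sqsubset> x \<or> u = x"
    using captive.prems(2) lex_less_snoc_E1D unfolding right_child_def by blast
  with captive show ?case by (simp add: free_root_captive)
qed (simp add: free_root_free)

lemma free_root_lex_le: "w \<in> nodes T \<Longrightarrow> free_root T w \<sqsubset> w \<or> free_root T w = w"
proof (induction rule: captive_induct)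
  case (captive u)
  have "u \<sqsubset> right_child u" by (simp add: right_child_def lex_less_append)
  with captive.IH show ?case
    using lex_less_trans unfolding free_root_captive[OF captive.hyps(2)] by auto
qed (simp add: free_root_free)

text \<open>The free root of \<open>v\<close> is a free node at or before \<open>v\<close>, hence
  before \<open>w\<close>, and \<open>free_root_greatest\<close> applies to it.\<close>

lemma free_root_mono:
  assumes "v \<in> nodes T" "w \<in> nodes T" "v \<sqsubset> w"
  shows "free_root T v \<sqsubset> free_root T w \<or> free_root T v = free_root T w"
proof (rule free_root_greatest[OF assms(2) free_root_in_free_nodes[OF assms(1)]])
  show "free_root T v \<sqsubset> w \<or> free_root T v = w"
    using free_root_lex_le[OF assms(1)] assms(3) lex_less_trans[of "free_root T v" v w] by auto
qed

text \<open>The integer part of a coordinate is the number of right edges on the path to its node, the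
  fractional part records the lexicographic position of its free root.\<close>

definition node_value :: "'a dtree \<Rightarrow> step list \<Rightarrow> real" where
  "node_value T w = real (rho_dot w) +
     real (card {u \<in> free_nodes T. u \<sqsubset> free_root T w}) / (real (card (free_nodes T)) + 1)"

lemma finite_free_nodes: "finite (free_nodes T)"
  by (simp add: free_nodes_def finite_nodes)

text \<open>The 1 added in the denominator of \<open>node_value\<close> keeps the fractional part
  strictly below 1.\<close>

lemma node_value_bounds: "real (rho_dot w) \<le> node_value T w" "node_value T w < real (rho_dot w) + 1"
proof -
  have "card {u \<in> free_nodes T. u \<sqsubset> free_root T w} \<le> card (free_nodes T)"
    by (rule card_mono) (auto simp: finite_free_nodes)
  then show "real (rho_dot w) \<le> node_value T w" "node_value T w < real (rho_dot w) + 1"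
    by (auto simp: node_value_def divide_less_eq)
qed

text \<open>The free root of \<open>v\<close> is itself a free node, counted for \<open>w\<close>
  but not for \<open>v\<close>.\<close>

lemma node_value_less:
  assumes "v \<in> nodes T" "free_root T v \<sqsubset> free_root T w"
  shows "node_value T v - rho_dot v < node_value T w - rho_dot w"
proof -
  have "card {u \<in> free_nodes T. u \<sqsubset> free_root T v} < card {u \<in> free_nodes T. u \<sqsubset> free_root T w}"
  proof (rule psubset_card_mono)
    show "{u \<in> free_nodes T. u \<sqsubset> free_root T v} \<subset> {u \<in> free_nodes T. u \<sqsubset> free_root T w}"
      using assms free_root_in_free_nodes[OF assms(1)] lex_less_trans lex_less_irrefl by blast
  qed (simp add: finite_free_nodes)
  then show ?thesis by (simp add: node_value_def divide_strict_right_mono)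
qed

text \<open>Distinct nodes with equal integer parts have distinct free roots, so their fractional
  parts decide; otherwise the integer parts do.\<close>

lemma node_value_strict_mono:
  assumes "v \<in> nodes T" "w \<in> nodes T" "v \<prec>\<^sub>T w"
  shows "node_value T v < node_value T w"
proof (cases "rho_dot v = rho_dot w")
  case True
  then have "free_root T v \<sqsubset> free_root T w"
    using assms free_root_mono[OF assms(1,2)] free_root_rho_dot_inject[OF assms(1,2)]
      vertex_less_irrefl by (auto simp: vertex_less_iff)
  with True show ?thesis using node_value_less[OF assms(1)] by fastforce
next
  case False
  then have "real (rho_dot v) + 1 \<le> real (rho_dot w)" using assms(3) by (simp add: vertex_less_iff)
  with node_value_bounds[where T = T and w = w] node_value_bounds[where T = T and w = v] show ?thesis by linarith
qed

text \<open>Fractional parts matter only if \<open>w\<close> has exactly one more right edge than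
  \<open>v\<close>. Then \<open>w\<close> precedes \<open>v\<close> lexicographically, since nothing
  lies between \<open>v\<close> and its right child, and a common free root would make
  \<open>w\<close> that right child.\<close>

lemma node_value_less_right_child:
  assumes "v \<in> nodes T" "w \<in> nodes T" "w \<prec>\<^sub>T right_child v"
  shows "node_value T w < node_value T v + 1"
proof (cases "rho_dot w = Suc (rho_dot v)")
  case True
  then have "w \<sqsubset> v @ [E1]" "w \<noteq> v" "w \<noteq> right_child v"
    using assms(3) vertex_less_irrefl by (auto simp: vertex_less_iff right_child_def)
  then have "w \<sqsubset> v" using lex_less_snoc_E1D by blast
  then have "free_root T w \<sqsubset> free_root T v"
    using free_root_mono[OF assms(2,1)] free_root_eq_right_child[OF assms(1,2) _ True]
      \<open>w \<noteq> right_child v\<close> by auto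
  from node_value_less[OF assms(2) this] True show ?thesis by simp
next
  case False
  then have "real (rho_dot w) \<le> real (rho_dot v)"
    using assms(3) by (simp add: vertex_less_iff right_child_def)
  with node_value_bounds[where T = T and w = w] node_value_bounds[where T = T and w = v] show ?thesis by linarith
qed

lemma node_value_right_child_less:
  assumes "v \<in> nodes T" "w \<in> nodes T" "right_child v \<prec>\<^sub>T w"
  shows "node_value T v + 1 < node_value T w"
proof (cases "rho_dot w = Suc (rho_dot v)")
  case True
  then have "right_child v \<sqsubset> w" "w \<noteq> right_child v"
    using assms(3) vertex_less_irrefl by (auto simp: vertex_less_iff right_child_def)
  then have "v \<sqsubset> w" using lex_less_append[of "[E1]" v] lex_less_trans
    unfolding right_child_def by blast
  then have "free_root T v \<sqsubset> free_root T w"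
    using free_root_mono[OF assms(1,2)] free_root_eq_right_child[OF assms(1,2) _ True]
      \<open>w \<noteq> right_child v\<close> by auto
  from node_value_less[OF assms(1) this] True show ?thesis by simp
next
  case False
  then have "real (rho_dot v) + 2 \<le> real (rho_dot w)"
    using assms(3) by (simp add: vertex_less_iff right_child_def)
  with node_value_bounds[where T = T and w = w] node_value_bounds[where T = T and w = v] show ?thesis by linarith
qed

lemma node_value_captive:
  assumes "captive T (right_child v)"
  shows "node_value T (right_child v) = node_value T v + 1"
  unfolding node_value_def free_root_captive[OF assms] by (simp add: right_child_def)

text \<open>A free right child is its own free root, lexicographically after the free root of
  \<open>v\<close>; hence the fractional part strictly increases along a solid right edge.\<close>

lemma node_value_not_captive:
  assumes "v \<in> nodes T" "right_child v \<in> nodes T" "\<not> captive T (right_child v)"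
  shows "node_value T v + 1 < node_value T (right_child v)"
proof -
  have "free_root T (right_child v) = right_child v"
    using assms by (intro free_root_free) (simp add: free_nodes_def)
  moreover have "free_root T v \<sqsubset> right_child v"
    using free_root_lex_le[OF assms(1)] lex_less_append[of "[E1]" v]
      lex_less_trans[of "free_root T v" v "v @ [E1]"]
    unfolding right_child_def by auto
  ultimately show ?thesis
    using node_value_less[OF assms(1), of "right_child v"] by (simp add: right_child_def)
qed

lemma face_conditions_node_value:
  fixes T :: "'n::{finite,linorder} dtree"
  assumes "decorated T"
  shows "face_conditions T (\<chi> i. node_value T (node_of T i))"
proof -
  note n = node_of_in_nodes[OF assms]
  have le: "node_value T v \<le> node_value T w \<longleftrightarrow> v \<preceq>\<^sub>T w" if "v \<in> nodes T" "w \<in> nodes T" for v w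
    using node_value_strict_mono[OF that] node_value_strict_mono[OF that(2,1)]
      vertex_less_linear[of v w] unfolding vertex_le_iff by fastforce
  have *: "(node_value T w < node_value T v + 1 \<longleftrightarrow> w \<prec>\<^sub>T right_child v) \<and>
    (node_value T w = node_value T v + 1 \<longleftrightarrow> w = right_child v \<and> captive T (right_child v))"
    if "v \<in> nodes T" "w \<in> nodes T" for v w
  proof -
    consider "w \<prec>\<^sub>T right_child v" | "w = right_child v" "captive T (right_child v)"
      | "w = right_child v" "\<not> captive T (right_child v)" | "right_child v \<prec>\<^sub>T w"
      using vertex_less_linear by blast
    then show ?thesis
    proof cases
      case 1
      then show ?thesis using node_value_less_right_child[OF that] vertex_less_irrefl by fastforce
    next
      case 2
      then show ?thesis using node_value_captive vertex_less_irrefl by fastforce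
    next
      case 3
      then show ?thesis using node_value_not_captive that vertex_less_irrefl by fastforce
    next
      case 4
      then show ?thesis
        using node_value_right_child_less[OF that 4] vertex_less_irrefl[of w]
          vertex_less_trans[of w "right_child v" w] by auto
    qed
  qed
  show ?thesis unfolding face_conditions_def using le[OF n n] *[OF n n] by simp
qed

section \<open>Faces as sets of points with the same signs\<close>

text \<open>A face is determined by any one of its points, so faces are indexed here by points
  instead of sign choices.\<close>

definition shi_cell :: "(real, 'n::{finite,linorder}) vec \<Rightarrow> (real, 'n) vec set" where
  "shi_cell p = {q. \<forall>i j. i < j \<longrightarrow>
     (\<forall>c\<in>{0, 1}. sgn (q $ i - q $ j - c) = sgn (p $ i - p $ j - c))}"

text \<open>Exactly one of the three relations holds at \<open>p\<close> for each hyperplane, so a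
  choice that is satisfied at \<open>p\<close> can be read off from the signs at \<open>p\<close>,
  and conversely.\<close>

lemma arrangement_faces_eq_sgn:
  "arrangement_faces H = range (\<lambda>p. {x. \<forall>(a, c)\<in>H. sgn (a \<bullet> x - c) = sgn (a \<bullet> p - c)})"
proof (intro set_eqI iffI)
  fix F assume "F \<in> arrangement_faces H"
  then obtain \<sigma> p where \<sigma>: "\<forall>h\<in>H. \<sigma> h \<in> {(<), (=), (>)}"
    and F: "F = {x. \<forall>(a, c)\<in>H. \<sigma> (a, c) (a \<bullet> x) c}" and p: "p \<in> F"
    unfolding arrangement_faces_def by blast
  have "\<sigma> (a, c) (a \<bullet> x) c \<longleftrightarrow> sgn (a \<bullet> x - c) = sgn (a \<bullet> p - c)" if "(a, c) \<in> H" for a c x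
  proof -
    have "\<sigma> (a, c) (a \<bullet> p) c" using p F that by blast
    moreover have "\<sigma> (a, c) \<in> {(<), (=), (>)}" using \<sigma> that by blast
    ultimately show ?thesis by (auto simp: sgn_if)
  qed
  then have "F = {x. \<forall>(a, c)\<in>H. sgn (a \<bullet> x - c) = sgn (a \<bullet> p - c)}" unfolding F by blast
  then show "F \<in> range (\<lambda>p. {x. \<forall>(a, c)\<in>H. sgn (a \<bullet> x - c) = sgn (a \<bullet> p - c)})" by blast
next
  fix F assume "F \<in> range (\<lambda>p. {x. \<forall>(a, c)\<in>H. sgn (a \<bullet> x - c) = sgn (a \<bullet> p - c)})"
  then obtain p where F: "F = {x. \<forall>(a, c)\<in>H. sgn (a \<bullet> x - c) = sgn (a \<bullet> p - c)}" by blast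
  define \<sigma> :: "'a \<times> real \<Rightarrow> real \<Rightarrow> real \<Rightarrow> bool" where
    "\<sigma> h = (if fst h \<bullet> p < snd h then (<) else if fst h \<bullet> p = snd h then (=) else (>))" for h
  have "\<sigma> (a, c) (a \<bullet> x) c \<longleftrightarrow> sgn (a \<bullet> x - c) = sgn (a \<bullet> p - c)" for a c x
    by (auto simp: \<sigma>_def sgn_if)
  then have "F = {x. \<forall>(a, c)\<in>H. \<sigma> (a, c) (a \<bullet> x) c}" unfolding F by simp
  moreover have "p \<in> F" unfolding F by auto
  moreover have "\<forall>h\<in>H. \<sigma> h \<in> {(<), (=), (>)}" by (auto simp: \<sigma>_def)
  ultimately show "F \<in> arrangement_faces H" unfolding arrangement_faces_def by blast
qed

lemma shi_faces_eq_cells: "arrangement_faces shi_arrangement = range shi_cell"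
proof -
  have "{x. \<forall>(a, c)\<in>shi_arrangement. sgn (a \<bullet> x - c) = sgn (a \<bullet> p - c)} = shi_cell p"
    for p :: "(real, 'a) vec"
  proof -
    have "(\<forall>(a, c)\<in>shi_arrangement. sgn (a \<bullet> x - c) = sgn (a \<bullet> p - c)) \<longleftrightarrow>
      (\<forall>i j. i < j \<longrightarrow> (\<forall>c\<in>{0, 1}. sgn ((axis i 1 - axis j 1) \<bullet> x - c)
         = sgn ((axis i 1 - axis j 1) \<bullet> p - c)))" for x
      unfolding shi_arrangement_def by blast
    then show ?thesis
      unfolding shi_cell_def by (simp add: inner_diff_left inner_axis')
  qed
  then show ?thesis unfolding arrangement_faces_eq_sgn by simp
qed

text \<open>Brings the signs into the shape of the three clauses of \<open>face_conditions\<close>.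
  The signs for \<open>c = 0\<close> and \<open>i < j\<close> encode both comparisons of the two
  coordinates.\<close>

lemma mem_shi_cell_iff:
  "q \<in> shi_cell p \<longleftrightarrow> (\<forall>i j. q $ i \<le> q $ j \<longleftrightarrow> p $ i \<le> p $ j) \<and>
     (\<forall>i j. i < j \<longrightarrow> (q $ i < q $ j + 1 \<longleftrightarrow> p $ i < p $ j + 1)) \<and>
     (\<forall>i j. i < j \<longrightarrow> (q $ i = q $ j + 1 \<longleftrightarrow> p $ i = p $ j + 1))" (is "?L \<longleftrightarrow> ?R")
proof -
  have 0: "sgn (q $ i - q $ j) = sgn (p $ i - p $ j) \<longleftrightarrow>
      (q $ i \<le> q $ j \<longleftrightarrow> p $ i \<le> p $ j) \<and> (q $ j \<le> q $ i \<longleftrightarrow> p $ j \<le> p $ i)" for i j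
    by (auto simp: sgn_if)
  have 1: "sgn (q $ i - q $ j - 1) = sgn (p $ i - p $ j - 1) \<longleftrightarrow>
      (q $ i < q $ j + 1 \<longleftrightarrow> p $ i < p $ j + 1) \<and> (q $ i = q $ j + 1 \<longleftrightarrow> p $ i = p $ j + 1)" for i j
    by (auto simp: sgn_if)
  have "?L \<longleftrightarrow> (\<forall>i j. i < j \<longrightarrow>
      ((q $ i \<le> q $ j \<longleftrightarrow> p $ i \<le> p $ j) \<and> (q $ j \<le> q $ i \<longleftrightarrow> p $ j \<le> p $ i)) \<and>
      (q $ i < q $ j + 1 \<longleftrightarrow> p $ i < p $ j + 1) \<and> (q $ i = q $ j + 1 \<longleftrightarrow> p $ i = p $ j + 1))"
    by (simp add: shi_cell_def 0 1)
  moreover have "(\<forall>i j. q $ i \<le> q $ j \<longleftrightarrow> p $ i \<le> p $ j) \<longleftrightarrow> (\<forall>i j. i < j \<longrightarrow>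
      (q $ i \<le> q $ j \<longleftrightarrow> p $ i \<le> p $ j) \<and> (q $ j \<le> q $ i \<longleftrightarrow> p $ j \<le> p $ i))" (is "?A \<longleftrightarrow> ?B")
  proof
    assume B: ?B
    show ?A
    proof (intro allI)
      fix i j
      show "q $ i \<le> q $ j \<longleftrightarrow> p $ i \<le> p $ j"
        using B by (cases i j rule: linorder_cases) auto
    qed
  qed blast
  ultimately show ?thesis by blast
qed

text \<open>The tree side of each clause does not involve the point: once \<open>p\<close> satisfies
  the conditions, \<open>q\<close> does so if and only if it makes the same comparisons as
  \<open>p\<close>.\<close>

lemma face_conditions_iff_cell:
  "face_conditions T p \<Longrightarrow> face_conditions T q \<longleftrightarrow> q \<in> shi_cell p"
  unfolding face_conditions_def mem_shi_cell_iff by simp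

lemma Psi_eq_cell:
  assumes "face_conditions T p"
  shows "Psi T = shi_cell p"
  unfolding Psi_def
  using face_conditions_iff_cell[OF assms] by (intro the_equality) (auto simp: shi_faces_eq_cells)

section \<open>Dimension\<close>

text \<open>The indicator vectors \<open>e y\<close> of the nonempty fibres form a basis; their
  supports are disjoint, so they are orthogonal.\<close>

lemma dim_constant_on_fibres:
  fixes f :: "'n::finite \<Rightarrow> 'b"
  shows "dim {x :: (real, 'n) vec. \<forall>i j. f i = f j \<longrightarrow> x $ i = x $ j} = card (range f)" (is "dim ?S = _")
proof -
  define e :: "'b \<Rightarrow> (real, 'n) vec" where "e y = (\<chi> i. if f i = y then 1 else 0)" for y
  have e_inj: "y = z" if "y \<in> range f" "e y = e z" for y z
  proof -
    from that(1) obtain i where "y = f i" by blast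
    moreover from that(2) have "e y $ i = e z $ i" by simp
    ultimately show ?thesis by (simp add: e_def split: if_splits)
  qed
  show ?thesis
  proof (rule dim_unique)
    show "e ` range f \<subseteq> ?S" by (auto simp: e_def)
    show "?S \<subseteq> span (e ` range f)"
    proof
      fix x assume x: "x \<in> ?S"
      \<comment> \<open>The coefficient of a fibre is the value of \<open>x\<close> at its
        representative \<open>inv f y\<close>.\<close>
      have "x = (\<Sum>y\<in>range f. x $ inv f y *\<^sub>R e y)"
      proof (rule vec_eq_iff[THEN iffD2], rule allI)
        fix i
        have "(\<Sum>y\<in>range f. x $ inv f y *\<^sub>R e y) $ i
            = (\<Sum>y\<in>range f. if f i = y then x $ inv f y else 0)"
          by (simp add: e_def if_distrib cong: if_cong)
        also have "\<dots> = x $ inv f (f i)" by simp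
        also have "\<dots> = x $ i" using x f_inv_into_f[of "f i" f UNIV] by blast
        finally show "x $ i = (\<Sum>y\<in>range f. x $ inv f y *\<^sub>R e y) $ i" by simp
      qed
      also have "\<dots> \<in> span (e ` range f)"
        by (intro span_sum span_scale span_base) auto
      finally show "x \<in> span (e ` range f)" .
    qed
    show "independent (e ` range f)"
    proof (rule pairwise_orthogonal_independent)
      have "e y \<bullet> e z = 0" if "y \<noteq> z" for y z
        using that by (auto simp: e_def inner_vec_def intro!: sum.neutral)
      then show "pairwise orthogonal (e ` range f)"
        unfolding pairwise_def orthogonal_def by (metis imageE)
      have "e (f i) $ i = 1" for i by (simp add: e_def)
      then have "e (f i) \<noteq> 0" for i by (metis zero_index zero_neq_one)
      then show "0 \<notin> e ` range f" by fastforce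
    qed
    show "card (e ` range f) = card (range f)"
      by (rule card_image) (use e_inj in \<open>auto simp: inj_on_def\<close>)
  qed
qed

lemma face_conditions_eq_iff:
  "face_conditions T p \<Longrightarrow> p $ i = p $ j \<longleftrightarrow> node_of T i = node_of T j"
  unfolding face_conditions_def order_eq_iff[of "p $ i"]
  using vertex_less_linear[of "node_of T i" "node_of T j"] by (auto simp: vertex_le_iff vertex_less_irrefl)

text \<open>Each dashed edge forces a difference of exactly 1 between the coordinates at its two
  ends. These differences add up along the chain to the free root.\<close>

lemma free_root_difference:
  fixes T :: "'n::{finite,linorder} dtree"
  assumes T: "T \<in> shi_trees" and p: "face_conditions T p"
    and "free_root T (node_of T i) = free_root T (node_of T j)"
  shows "p $ i - p $ j = real (rho_dot (node_of T i)) - real (rho_dot (node_of T j))"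
proof -
  have dec: "decorated T" using T by (simp add: shi_trees_def)
  have *: "\<forall>i k. node_of T i = w \<longrightarrow> node_of T k = free_root T w \<longrightarrow>
      p $ i - p $ k = real (rho_dot w) - real (rho_dot (free_root T w))" if "w \<in> nodes T" for w
    using that
  proof (induction rule: captive_induct)
    case (free w)
    then show ?case by (auto simp: free_root_free face_conditions_eq_iff[OF p])
  next
    case (captive u)
    have "right_child u \<in> nodes T" using captive.hyps(2) by (simp add: captive_def)
    \<comment> \<open>The descent supplies a pair to which condition (3) applies; other indices in
      the same labels have the same coordinates.\<close>
    then obtain a b where ab: "a < b" "node_of T a = right_child u" "node_of T b = u"
      by (rule shi_trees_descent[OF T])
    then have "p $ a = p $ b + 1"
      using p captive.hyps(2) unfolding face_conditions_def by blast
    show ?case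
    proof (intro allI impI)
      fix i k assume i: "node_of T i = right_child u" and k: "node_of T k = free_root T (right_child u)"
      have "p $ i = p $ a" using face_conditions_eq_iff[OF p] i ab(2) by simp
      moreover have "p $ b - p $ k = real (rho_dot u) - real (rho_dot (free_root T u))"
        using captive.IH ab(3) k by (simp add: free_root_captive[OF captive.hyps(2)])
      ultimately show "p $ i - p $ k =
          real (rho_dot (right_child u)) - real (rho_dot (free_root T (right_child u)))"
        using \<open>p $ a = p $ b + 1\<close>
        by (simp add: free_root_captive[OF captive.hyps(2)], simp add: right_child_def)
    qed
  qed
  have "free_root T (node_of T i) \<in> nodes T"
    using free_root_in_free_nodes[OF node_of_in_nodes[OF dec]] by (simp add: free_nodes_def)
  then obtain k where "node_of T k = free_root T (node_of T i)"
    using nodes_eq_range_node_of[OF dec] by (metis imageE)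
  with *[OF node_of_in_nodes[OF dec]] assms(3) show ?thesis by (smt (verit))
qed

text \<open>The equations valid at \<open>p\<close> hold throughout the translate of the subspace
  \<open>S\<close> by \<open>p\<close>, and the strict inequalities cut out an open set
  \<open>U\<close>. One dimension remains for each free node.\<close>

lemma aff_dim_Psi:
  fixes T :: "'n::{finite,linorder} dtree"
  assumes T: "T \<in> shi_trees"
  shows "aff_dim (Psi T) = int (card (free_nodes T))"
proof -
  have dec: "decorated T" using T by (simp add: shi_trees_def)
  obtain p where p: "face_conditions T p" using face_conditions_node_value[OF dec] by blast
  define f where "f i = free_root T (node_of T i)" for i
  define S where "S = {x :: (real, 'n) vec. \<forall>i j. f i = f j \<longrightarrow> x $ i = x $ j}"
  \<comment> \<open>\<open>I\<close> collects the hyperplanes avoiding \<open>p\<close>; these give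
    the strict inequalities.\<close>
  define I where "I = {(i, j, c). i < j \<and> c \<in> {0, 1} \<and> p $ i - p $ j \<noteq> c}"
  define U where "U = (\<Inter>(i, j, c)\<in>I. {q :: (real, 'n) vec. sgn (q $ i - q $ j - c) = sgn (p $ i - p $ j - c)})"
  have "finite I"
    by (rule finite_subset[of _ "UNIV \<times> UNIV \<times> {0, 1}"]) (auto simp: I_def)
  moreover have "open {q :: (real, 'n) vec. sgn (q $ i - q $ j - c) = sgn (p $ i - p $ j - c)}"
    if "(i, j, c) \<in> I" for i j c
  proof (cases "p $ i - p $ j < c")
    case True
    then have "{q :: (real, 'n) vec. sgn (q $ i - q $ j - c) = sgn (p $ i - p $ j - c)} = {q. q $ i - q $ j < c}"
      by (auto simp: sgn_if)
    then show ?thesis by (simp add: open_Collect_less continuous_intros)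
  next
    case False
    then have "p $ i - p $ j > c" using that by (auto simp: I_def)
    then have "{q :: (real, 'n) vec. sgn (q $ i - q $ j - c) = sgn (p $ i - p $ j - c)} = {q. c < q $ i - q $ j}"
      by (auto simp: sgn_if)
    then show ?thesis by (simp add: open_Collect_less continuous_intros)
  qed
  ultimately have "open U" unfolding U_def by (intro open_INT) auto
  \<comment> \<open>An equation at \<open>p\<close> puts both indices at one node or at the ends of
    a dashed edge, in either case under one free root.\<close>
  have f_eq: "f i = f j" if "p $ i - p $ j = c" "i < j" "c \<in> {0, 1}" for i j c
  proof (cases "c = 0")
    case True
    with that show ?thesis using face_conditions_eq_iff[OF p] by (simp add: f_def)
  next
    case False
    with that have "p $ i = p $ j + 1" by auto
    with p that(2) have "node_of T i = right_child (node_of T j)" "captive T (right_child (node_of T j))"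
      unfolding face_conditions_def by blast+
    then show ?thesis by (simp add: f_def free_root_captive)
  qed
  have "shi_cell p = (+) p ` S \<inter> U"
  proof (intro set_eqI iffI)
    fix q assume q: "q \<in> shi_cell p"
    then have "face_conditions T q" using face_conditions_iff_cell[OF p] by blast
    then have "q $ i - q $ j = p $ i - p $ j" if "f i = f j" for i j
      using free_root_difference[OF T] p that unfolding f_def by metis
    then have "q - p \<in> S" unfolding S_def by (auto simp: algebra_simps)
    then have "q \<in> (+) p ` S" by (intro image_eqI[of _ _ "q - p"]) auto
    moreover have "q \<in> U" using q by (auto simp: U_def I_def shi_cell_def)
    ultimately show "q \<in> (+) p ` S \<inter> U" by blast
  next
    fix q assume "q \<in> (+) p ` S \<inter> U"
    then obtain x where x: "x \<in> S" "q = p + x" and qU: "q \<in> U" by blast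
    have "sgn (q $ i - q $ j - c) = sgn (p $ i - p $ j - c)" if "i < j" "c \<in> {0, 1}" for i j c
    proof (cases "p $ i - p $ j = c")
      case True
      then have "f i = f j" using that by (rule f_eq)
      then have "x $ i = x $ j" using x(1) unfolding S_def by blast
      then show ?thesis using x(2) by simp
    next
      case False
      then have "(i, j, c) \<in> I" using that by (simp add: I_def)
      then show ?thesis using qU unfolding U_def by blast
    qed
    then show "q \<in> shi_cell p" unfolding shi_cell_def by blast
  qed
  moreover have S: "subspace S"
  proof (rule subspaceI)
    show "0 \<in> S" by (simp add: S_def)
    show "x + y \<in> S" if "x \<in> S" "y \<in> S" for x y
      using that unfolding S_def mem_Collect_eq vector_add_component by metis
    show "c *\<^sub>R x \<in> S" if "x \<in> S" for c x
      using that unfolding S_def mem_Collect_eq vector_scaleR_component by metis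
  qed
  have "affine ((+) p ` S)"
    using subspace_imp_affine[OF S] by (simp add: affine_translation[symmetric])
  moreover have "p \<in> shi_cell p" by (auto simp: shi_cell_def)
  \<comment> \<open>An affine set and its nonempty intersection with an open set have the same
    affine hull.\<close>
  ultimately have "affine hull shi_cell p = affine hull ((+) p ` S)"
    using affine_hull_affine_Int_open[OF _ \<open>open U\<close>, of "(+) p ` S"] by auto
  then have "aff_dim (shi_cell p) = aff_dim ((+) p ` S)"
    using aff_dim_affine_hull[of "shi_cell p"] aff_dim_affine_hull[of "(+) p ` S"] by simp
  also have "\<dots> = int (dim S)" by (simp add: aff_dim_translation_eq aff_dim_subspace S)
  also have "dim S = card (range f)" unfolding S_def by (rule dim_constant_on_fibres)
  also have "range f = free_nodes T"
    using free_root_image[of T] by (simp add: nodes_eq_range_node_of[OF dec] f_def image_image)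
  finally show ?thesis using Psi_eq_cell[OF p] by simp
qed

section \<open>Uniqueness of the tree\<close>

lemma face_conditions_less_iff:
  "face_conditions T p \<Longrightarrow> p $ i < p $ j \<longleftrightarrow> node_of T i \<prec>\<^sub>T node_of T j"
  unfolding face_conditions_def vertex_le_iff by (metis not_less)

lemma right_dashed_iff_captive:
  assumes "decorated T" "v \<in> nodes T"
  shows "right_dashed T v \<longleftrightarrow> captive T (right_child v)"
  using assms by (auto simp: decorated_def captive_def)

text \<open>The position of \<open>i\<close> in \<open>T'\<close> is a lower bound for its position
  in \<open>T\<close>: the parent in \<open>T'\<close> carries smaller coordinates, already placed
  alike in both trees. Exchanging the trees then gives equality.\<close>

lemma node_of_not_less:
  fixes T T' :: "'n::{finite,linorder} dtree"
  assumes T': "T' \<in> shi_trees"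
    and p: "face_conditions T p" "face_conditions T' p"
    and IH: "\<And>j. p $ j < p $ i \<Longrightarrow> node_of T j = node_of T' j"
  shows "\<not> node_of T i \<prec>\<^sub>T node_of T' i"
proof
  assume less: "node_of T i \<prec>\<^sub>T node_of T' i"
  have dec: "decorated T'" using T' by (simp add: shi_trees_def)
  have i: "node_of T' i \<in> nodes T'" by (rule node_of_in_nodes[OF dec])
  consider "node_of T' i = []" | u where "node_of T' i = left_child u"
    | u where "node_of T' i = right_child u" by (rule vertex_cases)
  then show False
  proof cases
    case 1
    then show False using less not_vertex_less_Nil by simp
  next
    case (2 u)
    then have "u \<in> nodes T'" using i nodes_left_childD by simp
    then obtain j where j: "u = node_of T' j" using nodes_eq_range_node_of[OF dec] by blast
    then have "p $ j < p $ i"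
      using face_conditions_less_iff[OF p(2)] 2 vertex_less_left_child by simp
    \<comment> \<open>No vertex lies strictly between \<open>u\<close> and its left child.\<close>
    then have "u \<prec>\<^sub>T node_of T i"
      using IH j face_conditions_less_iff[OF p(1)] by metis
    then show False
      using less vertex_less_left_childD[of "node_of T i" u] 2 by (simp add: vertex_le_iff)
  next
    case (3 u)
    then obtain a b where ab: "a < b" "node_of T' a = right_child u" "node_of T' b = u"
      using shi_trees_descent[OF T'] i by metis
    then have "p $ a = p $ i" using 3 face_conditions_eq_iff[OF p(2)] by simp
    then have a: "node_of T a = node_of T i" using face_conditions_eq_iff[OF p(1)] by simp
    have "p $ b < p $ i"
      using face_conditions_less_iff[OF p(2)] ab(3) 3 vertex_less_right_child by simp
    then have b: "node_of T b = u" using IH ab(3) by simp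
    \<comment> \<open>The descent pair transfers the lower bound \<open>right_child u\<close> from
      \<open>T'\<close> to \<open>T\<close> by condition (2).\<close>
    have "\<not> p $ a < p $ b + 1"
      using p(2) ab vertex_less_irrefl unfolding face_conditions_def by metis
    then have "\<not> node_of T i \<prec>\<^sub>T right_child u"
      using p(1) ab(1) a b unfolding face_conditions_def by metis
    with less 3 show False by simp
  qed
qed

lemma shi_tree_unique:
  fixes T T' :: "'n::{finite,linorder} dtree"
  assumes T: "T \<in> shi_trees" "T' \<in> shi_trees"
    and p: "face_conditions T p" "face_conditions T' p"
  shows "T = T'"
proof -
  have dec: "decorated T" "decorated T'" using T by (simp_all add: shi_trees_def)
  have eq: "node_of T i = node_of T' i" for i
  proof (induction "card {j. p $ j < p $ i}" arbitrary: i rule: less_induct)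
    case less
    have IH: "node_of T j = node_of T' j" if "p $ j < p $ i" for j
    proof (rule less.hyps)
      show "card {k. p $ k < p $ j} < card {k. p $ k < p $ i}"
        using that by (intro psubset_card_mono) auto
    qed
    have "\<not> node_of T i \<prec>\<^sub>T node_of T' i"
      by (rule node_of_not_less[OF T(2) p IH])
    moreover have "\<not> node_of T' i \<prec>\<^sub>T node_of T i"
      by (rule node_of_not_less[OF T(1) p(2,1) IH[symmetric]])
    ultimately show ?case using vertex_less_linear by blast
  qed
  have nodes: "nodes T = nodes T'"
    by (simp add: nodes_eq_range_node_of dec eq)
  \<comment> \<open>A descent pair across the edge shows whether it is dashed, through the equation
    in condition (3).\<close>
  have captive_iff: "captive T (right_child v) \<longleftrightarrow> captive T' (right_child v)" for v
  proof (cases "right_child v \<in> nodes T")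
    case True
    then obtain a b where ab: "a < b" "node_of T a = right_child v" "node_of T b = v"
      by (rule shi_trees_descent[OF T(1)])
    then have "captive T (right_child v) \<longleftrightarrow> p $ a = p $ b + 1"
      using p(1) unfolding face_conditions_def by simp
    moreover have "captive T' (right_child v) \<longleftrightarrow> p $ a = p $ b + 1"
      using p(2) ab unfolding face_conditions_def by (simp add: eq)
    ultimately show ?thesis by simp
  next
    case False
    then show ?thesis using nodes by (simp add: captive_def)
  qed
  show ?thesis
  proof (rule dtree_eqI[OF nodes])
    fix v assume v: "v \<in> nodes T"
    with nodes have v': "v \<in> nodes T'" by simp
    show "node_label T v = node_label T' v"
      using node_of_eq_iff[OF dec(1) v] node_of_eq_iff[OF dec(2) v'] eq by auto
    show "right_dashed T v = right_dashed T' v"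
      using right_dashed_iff_captive[OF dec(1) v] right_dashed_iff_captive[OF dec(2) v'] captive_iff
      by simp
  qed
qed

section \<open>Construction of the tree\<close>

lemma finite_vertex_max:
  "finite C \<Longrightarrow> C \<noteq> {} \<Longrightarrow> \<exists>c\<in>C. \<forall>d\<in>C. d \<preceq>\<^sub>T c"
proof (induction rule: finite_ne_induct)
  case (singleton x)
  then show ?case by (simp add: vertex_le_def)
next
  case (insert x C)
  then obtain c where c: "c \<in> C" "\<forall>d\<in>C. d \<preceq>\<^sub>T c" by blast
  show ?case
  proof (cases "x \<preceq>\<^sub>T c")
    case True
    with c show ?thesis by blast
  next
    case False
    then have "c \<prec>\<^sub>T x" by (simp add: vertex_le_iff)
    then have "d \<preceq>\<^sub>T x" if "d \<in> C" for d
      using c(2) that vertex_less_trans[of d c x] unfolding vertex_le_def by auto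
    then show ?thesis by (auto simp: vertex_le_def)
  qed
qed

text \<open>\<open>Y\<close> stands for the coordinate values, and \<open>D y z\<close> for a
  descent from \<open>y\<close> to \<open>z\<close> at distance at least 1. The second clause makes
  the words the nodes of a tree whose right edges are descents; the last two locate words relative
  to right children, as condition (2) requires.\<close>

lemma exists_word_assignment:
  fixes Y :: "real set"
  assumes "finite Y" and D: "\<And>y z. D y z \<Longrightarrow> y + 1 \<le> z"
  shows "\<exists>W. (\<forall>y\<in>Y. \<forall>z\<in>Y. y < z \<longrightarrow> W y \<prec>\<^sub>T W z) \<and>
    (\<forall>z\<in>Y. W z = [] \<or> (\<exists>y\<in>Y. W z = left_child (W y)) \<or> (\<exists>y\<in>Y. D y z \<and> W z = right_child (W y))) \<and>
    (\<forall>y\<in>Y. \<forall>z\<in>Y. D y z \<longrightarrow> right_child (W y) \<preceq>\<^sub>T W z) \<and>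
    (\<forall>y\<in>Y. \<forall>z\<in>Y. right_child (W y) \<prec>\<^sub>T W z \<longrightarrow> y + 1 < z)"
  using assms(1)
proof (induction rule: finite_linorder_max_induct)
  case (insert b A)
  then obtain W where mono: "\<And>y z. y \<in> A \<Longrightarrow> z \<in> A \<Longrightarrow> y < z \<Longrightarrow> W y \<prec>\<^sub>T W z"
    and par: "\<And>z. z \<in> A \<Longrightarrow> W z = [] \<or> (\<exists>y\<in>A. W z = left_child (W y)) \<or>
        (\<exists>y\<in>A. D y z \<and> W z = right_child (W y))"
    and desc: "\<And>y z. y \<in> A \<Longrightarrow> z \<in> A \<Longrightarrow> D y z \<Longrightarrow> right_child (W y) \<preceq>\<^sub>T W z"
    and gap: "\<And>y z. y \<in> A \<Longrightarrow> z \<in> A \<Longrightarrow> right_child (W y) \<prec>\<^sub>T W z \<Longrightarrow> y + 1 < z"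
    by blast
  have b: "y < b" if "y \<in> A" for y using insert.hyps(2) that by blast
  then have "b \<notin> A" by blast
  have notD: "\<not> D b z" if "z \<in> insert b A" for z using D[of b z] b that by fastforce
  have less: "y < z" if "y \<in> A" "z \<in> A" "W y \<prec>\<^sub>T W z" for y z
    using mono[OF that(2,1)] that(3) vertex_less_irrefl vertex_less_trans
    by (metis linorder_neqE_linordered_idom)
  have inj: "y = z" if "y \<in> A" "z \<in> A" "W y = W z" for y z
    using mono[OF that(1,2)] mono[OF that(2,1)] that(3) vertex_less_irrefl
    by (metis linorder_neqE_linordered_idom)
  \<comment> \<open>A word determines its parent, and \<open>W\<close> is injective, so the parent
    given by \<open>par\<close> is \<open>W y\<close>.\<close>
  have right: "D y z" if yz: "y \<in> A" "z \<in> A" "W z = right_child (W y)" for y z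
  proof -
    have "W z \<noteq> []" using yz(3) by (simp add: right_child_def)
    then obtain x where "x \<in> A" "D x z" "W z = right_child (W x)" using par[OF yz(2)] yz(3) by auto
    with inj[of x y] yz show ?thesis by simp
  qed
  show ?case
  proof (cases "A = {}")
    case True
    then show ?thesis
      using notD[of b] not_vertex_less_Nil by (intro exI[of _ "\<lambda>_. []"]) auto
  next
    case False
    define m where "m = Max A"
    have m: "m \<in> A" "\<And>y. y \<in> A \<Longrightarrow> y \<le> m" using False insert.hyps(1) by (auto simp: m_def)
    \<comment> \<open>The left child of the last word is needed for monotonicity, the right children
      for the third clause. The maximum of \<open>C\<close> meets all these bounds and still has its
      parent among the earlier words.\<close>
    define C where "C = insert (left_child (W m)) ((\<lambda>y. right_child (W y)) ` {y \<in> A. D y b})"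
    have "finite C" "C \<noteq> {}" using insert.hyps(1) by (auto simp: C_def)
    then obtain c where c: "c \<in> C" "\<And>d. d \<in> C \<Longrightarrow> d \<preceq>\<^sub>T c"
      using finite_vertex_max[of C] by metis
    have above: "W y \<prec>\<^sub>T c" if "y \<in> A" for y
    proof -
      have "W y \<prec>\<^sub>T W m \<or> W y = W m" using mono[OF that m(1)] m(2)[OF that] by fastforce
      then have "W y \<prec>\<^sub>T left_child (W m)"
        using vertex_less_left_child[of "W m"] vertex_less_trans by auto
      moreover have "left_child (W m) \<preceq>\<^sub>T c" using c(2) by (simp add: C_def)
      ultimately show ?thesis unfolding vertex_le_def using vertex_less_trans by auto
    qed
    \<comment> \<open>If \<open>c\<close> is the left child of \<open>W m\<close>, then
      \<open>right_child (W y)\<close> is at most \<open>W m\<close>, so already \<open>m\<close> is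
      at distance at least 1 from \<open>y\<close>. If \<open>c\<close> is the right child of
      \<open>W x\<close>, then \<open>y < x\<close> and \<open>x + 1\<close> is at most
      \<open>b\<close>.\<close>
    have gap_b: "y + 1 < b" if y: "y \<in> A" and less_c: "right_child (W y) \<prec>\<^sub>T c" for y
    proof -
      consider "c = left_child (W m)" | x where "x \<in> A" "D x b" "c = right_child (W x)"
        using c(1) by (auto simp: C_def)
      then show ?thesis
      proof cases
        case 1
        then have "right_child (W y) \<preceq>\<^sub>T W m" using less_c vertex_less_left_childD by simp
        then have "y + 1 \<le> m"
          unfolding vertex_le_def using gap[OF y m(1)] right[OF y m(1)] D[of y m] by fastforce
        with b[OF m(1)] show ?thesis by simp
      next
        case 2
        then have "y < x" using less_c less y by (simp add: right_child_less_iff)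
        with D[OF 2(2)] show ?thesis by simp
      qed
    qed
    \<comment> \<open>No word lies beyond \<open>right_child c\<close>, so the last clause is
      vacuous when \<open>b\<close> is its smaller value.\<close>
    have not_above: "\<not> right_child c \<prec>\<^sub>T W' z" if "z \<in> insert b A" "W' = W(b := c)" for z W'
      using above[of z] that vertex_less_right_child[of c] vertex_less_trans vertex_less_irrefl
      by (metis fun_upd_apply insert_iff)
    show ?thesis
    proof (intro exI[of _ "W(b := c)"] conjI ballI impI)
      fix y z assume yz: "y \<in> insert b A" "z \<in> insert b A"
      show "(W(b := c)) y \<prec>\<^sub>T (W(b := c)) z" if "y < z"
        using yz that above mono b \<open>b \<notin> A\<close> by (auto dest: less_asym)
      show "right_child ((W(b := c)) y) \<preceq>\<^sub>T (W(b := c)) z" if "D y z"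
      proof -
        have "y \<in> A" using yz notD[OF yz(2)] that by blast
        then show ?thesis
          using yz(2) that desc \<open>b \<notin> A\<close> c(2)[of "right_child (W y)"] by (auto simp: C_def)
      qed
      show "y + 1 < z" if "right_child ((W(b := c)) y) \<prec>\<^sub>T (W(b := c)) z"
      proof -
        have "y \<in> A" using yz not_above[OF yz(2) refl] that by auto
        then show ?thesis using yz(2) that gap gap_b \<open>b \<notin> A\<close> by (auto split: if_splits)
      qed
    next
      fix z assume "z \<in> insert b A"
      then consider "z = b" | "z \<in> A" "z \<noteq> b" using \<open>b \<notin> A\<close> by blast
      then show "(W(b := c)) z = [] \<or> (\<exists>y\<in>insert b A. (W(b := c)) z = left_child ((W(b := c)) y)) \<or>
          (\<exists>y\<in>insert b A. D y z \<and> (W(b := c)) z = right_child ((W(b := c)) y))"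
      proof cases
        case 1
        have "m \<noteq> b" using m(1) \<open>b \<notin> A\<close> by blast
        consider "c = left_child (W m)" | x where "x \<in> A" "D x b" "c = right_child (W x)" "x \<noteq> b"
          using c(1) \<open>b \<notin> A\<close> by (auto simp: C_def)
        then show ?thesis
        proof cases
          case 1
          then have "(W(b := c)) z = left_child ((W(b := c)) m)"
            using \<open>z = b\<close> \<open>m \<noteq> b\<close> by simp
          then show ?thesis using m(1) by blast
        next
          case 2
          then have "(W(b := c)) z = right_child ((W(b := c)) x)" "D x z" using \<open>z = b\<close> by simp_all
          then show ?thesis using 2(1) by blast
        qed
      next
        case 2
        have "(W(b := c)) y = W y" if "y \<in> A" for y using that \<open>b \<notin> A\<close> by auto
        with par[OF 2(1)] 2(1) show ?thesis by (metis insertI2)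
      qed
    qed
  qed
qed simp

text \<open>The nodes are the classes of equal coordinates, placed at the words assigned to their
  values.\<close>

lemma shi_tree_exists:
  fixes p :: "(real, 'n::{finite,linorder}) vec"
  shows "\<exists>T\<in>shi_trees. face_conditions T p"
proof -
  define Y where "Y = range (($) p)"
  define D where "D y z \<longleftrightarrow> y + 1 \<le> z \<and> (\<exists>i j. i < j \<and> p $ i = z \<and> p $ j = y)" for y z
  have pY: "p $ i \<in> Y" for i by (simp add: Y_def)
  obtain W where mono: "\<And>y z. y \<in> Y \<Longrightarrow> z \<in> Y \<Longrightarrow> y < z \<Longrightarrow> W y \<prec>\<^sub>T W z"
    and par: "\<And>z. z \<in> Y \<Longrightarrow> W z = [] \<or> (\<exists>y\<in>Y. W z = left_child (W y)) \<or>
        (\<exists>y\<in>Y. D y z \<and> W z = right_child (W y))"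
    and desc: "\<And>y z. y \<in> Y \<Longrightarrow> z \<in> Y \<Longrightarrow> D y z \<Longrightarrow> right_child (W y) \<preceq>\<^sub>T W z"
    and gap: "\<And>y z. y \<in> Y \<Longrightarrow> z \<in> Y \<Longrightarrow> right_child (W y) \<prec>\<^sub>T W z \<Longrightarrow> y + 1 < z"
  proof -
    have "y + 1 \<le> z" if "D y z" for y z using that by (simp add: D_def)
    moreover have "finite Y" by (simp add: Y_def)
    ultimately show ?thesis using exists_word_assignment[of Y D] that by blast
  qed
  have inj: "y = z" if "y \<in> Y" "z \<in> Y" "W y = W z" for y z
    using mono[OF that(1,2)] mono[OF that(2,1)] that(3) vertex_less_irrefl
    by (metis linorder_neqE_linordered_idom)
  have right: "D y z" if yz: "y \<in> Y" "z \<in> Y" "W z = right_child (W y)" for y z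
  proof -
    have "W z \<noteq> []" using yz(3) by (simp add: right_child_def)
    then obtain x where "x \<in> Y" "D x z" "W z = right_child (W x)" using par[OF yz(2)] yz(3) by auto
    with inj[of x y] yz show ?thesis by simp
  qed
  define lab where "lab v = {i. W (p $ i) = v}" for v
  \<comment> \<open>Dashed are the right edges along which the value grows by exactly 1.\<close>
  define dsh where "dsh v \<longleftrightarrow> (\<exists>y\<in>Y. v = W y \<and> y + 1 \<in> Y \<and> W (y + 1) = right_child v)" for v
  have "\<exists>T. nodes T = W ` Y \<and>
      (\<forall>v\<in>W ` Y. node_label T v = lab v \<and> (right_dashed T v \<longleftrightarrow> dsh v))"
  proof (rule dtree_of_words)
    fix v s assume "v @ [s] \<in> W ` Y"
    then obtain z where z: "z \<in> Y" "W z = v @ [s]" by force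
    then show "v \<in> W ` Y" using par[OF z(1)] by (auto simp: left_child_def right_child_def)
  qed (simp add: Y_def)
  then obtain T where nodes: "nodes T = W ` Y"
    and lab: "\<And>v. v \<in> W ` Y \<Longrightarrow> node_label T v = lab v"
    and dsh: "\<And>v. v \<in> W ` Y \<Longrightarrow> right_dashed T v \<longleftrightarrow> dsh v" by blast
  have lab_image: "node_label T ` nodes T = lab ` W ` Y" using lab nodes by simp
  have lab_ex: "\<exists>i. v = W (p $ i)" if "v \<in> W ` Y" for v using that by (auto simp: Y_def)
  have dec: "decorated T"
    unfolding decorated_def
  proof (intro conjI ballI impI)
    show "inj_on (node_label T) (nodes T)"
    proof (rule inj_onI)
      fix v w assume vw: "v \<in> nodes T" "w \<in> nodes T" "node_label T v = node_label T w"
      then have "lab v = lab w" using lab nodes by simp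
      moreover obtain i where "v = W (p $ i)" using lab_ex vw(1) nodes by blast
      ultimately show "v = w" unfolding lab_def by blast
    qed
    show "partition_on UNIV (node_label T ` nodes T)"
      unfolding lab_image
    proof (rule partition_onI)
      show "\<Union> (lab ` W ` Y) = UNIV" using pY by (auto simp: lab_def)
      show "disjnt q r" if "q \<in> lab ` W ` Y" "r \<in> lab ` W ` Y" "q \<noteq> r" for q r
        using that by (auto simp: lab_def disjnt_def)
      show "{} \<notin> lab ` W ` Y"
        using lab_ex by (fastforce simp: lab_def)
    qed
    show "right_child v \<in> nodes T" if "v \<in> nodes T" "right_dashed T v" for v
    proof -
      have "dsh v" using that dsh nodes by simp
      then obtain y where "y + 1 \<in> Y" "W (y + 1) = right_child v" unfolding dsh_def by blast
      then show ?thesis using nodes by (metis imageI)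
    qed
  qed
  have node_of: "node_of T i = W (p $ i)" for i
    using pY by (intro node_of_eqI[OF dec]) (auto simp: nodes lab lab_def)
  have "shi_type T"
    unfolding shi_type_def
  proof (intro allI impI)
    fix v assume edge: "internal_edge T v (right_child v)"
    then obtain y z where yz: "y \<in> Y" "v = W y" "z \<in> Y" "W z = right_child (W y)"
      unfolding internal_edge_def nodes by force
    then have "D y z" by (intro right)
    then obtain i j where ij: "i < j" "p $ i = z" "p $ j = y" unfolding D_def by blast
    have nl: "node_label T v = lab v" "node_label T (right_child v) = lab (right_child v)"
      using lab edge by (auto simp: internal_edge_def nodes)
    have "Min (lab (right_child v)) \<le> i" using ij yz by (intro Min_le) (auto simp: lab_def)
    moreover have "j \<le> Max (lab v)" using ij yz by (intro Max_ge) (auto simp: lab_def)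
    ultimately show "descent T v (right_child v)"
      using edge ij(1) unfolding descent_def nl by simp
  qed
  with dec have "T \<in> shi_trees" by (simp add: shi_trees_def)
  moreover have "face_conditions T p"
    unfolding face_conditions_def node_of
  proof (intro conjI allI impI)
    fix i j
    show "p $ i \<le> p $ j \<longleftrightarrow> W (p $ i) \<preceq>\<^sub>T W (p $ j)"
      using mono[OF pY pY, of i j] mono[OF pY pY, of j i]
      by (cases "p $ i" "p $ j" rule: linorder_cases) (auto simp: vertex_le_iff vertex_less_irrefl dest: vertex_less_trans)
  next
    fix i j :: 'n assume "i < j"
    have D: "D (p $ j) (p $ i) \<longleftrightarrow> \<not> p $ i < p $ j + 1" using \<open>i < j\<close> by (auto simp: D_def)
    \<comment> \<open>From left to right, equality gives a descent by \<open>right\<close>, and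
      strict inequality a distance above 1 by \<open>gap\<close>.\<close>
    have *: "right_child (W (p $ j)) \<preceq>\<^sub>T W (p $ i) \<longleftrightarrow> D (p $ j) (p $ i)"
      using desc[OF pY pY, of j i] gap[OF pY pY, of j i] right[OF pY pY, of i j] D
      unfolding vertex_le_def by auto
    then show "p $ i < p $ j + 1 \<longleftrightarrow> W (p $ i) \<prec>\<^sub>T right_child (W (p $ j))"
      using D vertex_le_iff by blast
    have captive: "captive T (right_child (W (p $ j))) \<longleftrightarrow> dsh (W (p $ j))"
      using right_dashed_iff_captive[OF dec] dsh pY nodes by blast
    show "p $ i = p $ j + 1 \<longleftrightarrow>
        W (p $ i) = right_child (W (p $ j)) \<and> captive T (right_child (W (p $ j)))"
      unfolding captive
    proof
      assume eq: "p $ i = p $ j + 1"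
      then have "D (p $ j) (p $ i)" using D by simp
      then have "right_child (W (p $ j)) \<preceq>\<^sub>T W (p $ i)" using * by blast
      moreover have "\<not> right_child (W (p $ j)) \<prec>\<^sub>T W (p $ i)"
        using gap[OF pY pY, of j i] eq by auto
      ultimately have "W (p $ i) = right_child (W (p $ j))" by (simp add: vertex_le_def)
      moreover from this have "dsh (W (p $ j))"
        unfolding dsh_def using eq pY by metis
      ultimately show "W (p $ i) = right_child (W (p $ j)) \<and> dsh (W (p $ j))" by blast
    next
      assume *: "W (p $ i) = right_child (W (p $ j)) \<and> dsh (W (p $ j))"
      then obtain y where y: "y \<in> Y" "W (p $ j) = W y" "y + 1 \<in> Y" "W (y + 1) = W (p $ i)"
        unfolding dsh_def by auto
      \<comment> \<open>By injectivity of \<open>W\<close> the witness \<open>y\<close> is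
        \<open>p $ j\<close> and \<open>y + 1\<close> is \<open>p $ i\<close>.\<close>
      from inj[OF pY y(1,2)] inj[OF y(3) pY y(4)] show "p $ i = p $ j + 1" by simp
    qed
  qed
  ultimately show ?thesis by blast
qed

theorem theorem2p19:
  shows "(\<forall>T \<in> (shi_trees :: 'n::{finite,linorder} dtree set).
            \<exists>!F. F \<in> arrangement_faces shi_arrangement \<and> (\<forall>p. p \<in> F \<longleftrightarrow> face_conditions T p)) \<and>
         bij_betw Psi (shi_trees :: 'n dtree set) (arrangement_faces shi_arrangement) \<and>
         (\<forall>T \<in> (shi_trees :: 'n dtree set). \<forall>k::nat.
            card (free_nodes T) = k \<longleftrightarrow> aff_dim (Psi T) = int k)"
proof (intro conjI ballI allI)
  fix T :: "'n dtree" assume T: "T \<in> shi_trees"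
  then obtain p where p: "face_conditions T p"
    using face_conditions_node_value by (auto simp: shi_trees_def)
  show "\<exists>!F. F \<in> arrangement_faces shi_arrangement \<and> (\<forall>p. p \<in> F \<longleftrightarrow> face_conditions T p)"
    using face_conditions_iff_cell[OF p]
    by (intro ex1I[of _ "shi_cell p"]) (auto simp: shi_faces_eq_cells)
  show "card (free_nodes T) = k \<longleftrightarrow> aff_dim (Psi T) = int k" for k
    using aff_dim_Psi[OF T] by simp
next
  have ex: "\<exists>p. face_conditions T p" if "T \<in> (shi_trees :: 'n dtree set)" for T
    using that face_conditions_node_value by (auto simp: shi_trees_def)
  show "bij_betw Psi (shi_trees :: 'n dtree set) (arrangement_faces shi_arrangement)"
    unfolding bij_betw_def
  proof
    show "inj_on Psi (shi_trees :: 'n dtree set)"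
    proof (rule inj_onI)
      fix T T' :: "'n dtree" assume T: "T \<in> shi_trees" "T' \<in> shi_trees" "Psi T = Psi T'"
      obtain p q where p: "face_conditions T p" and q: "face_conditions T' q"
        using ex T by blast
      \<comment> \<open>Equal faces give one point satisfying the conditions of both trees, the
        situation of \<open>shi_tree_unique\<close>.\<close>
      have "p \<in> shi_cell q"
        using T(3) Psi_eq_cell[OF p] Psi_eq_cell[OF q] face_conditions_iff_cell[OF p] p by simp
      then have "face_conditions T' p" using face_conditions_iff_cell[OF q] by blast
      with T(1,2) p show "T = T'" by (rule shi_tree_unique)
    qed
    show "Psi ` (shi_trees :: 'n dtree set) = arrangement_faces shi_arrangement"
    proof (intro set_eqI iffI)
      fix F :: "(real, 'n) vec set" assume "F \<in> Psi ` shi_trees"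
      then obtain T where "T \<in> shi_trees" "F = Psi T" by blast
      then show "F \<in> arrangement_faces shi_arrangement"
        using ex[of T] Psi_eq_cell by (auto simp: shi_faces_eq_cells)
    next
      fix F :: "(real, 'n) vec set" assume "F \<in> arrangement_faces shi_arrangement"
      then obtain p where F: "F = shi_cell p" by (auto simp: shi_faces_eq_cells)
      obtain T where "T \<in> shi_trees" "face_conditions T p" using shi_tree_exists by blast
      with F show "F \<in> Psi ` shi_trees" using Psi_eq_cell by blast
    qed
  qed
qed

end
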